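(* Let $0<q<p\le1$, $k\in\mathbb{Z}$ and $n\ge1$. Then $$E_{n,p,q}^{(k)}(x)=\sum_{l=0}^\infty\sum_{i=0}^l\sum_{j=0}^{i+1} \frac{2(-1)^{l-i-j}}{[i+1]^k_{p,q}}\binom{i+1}{j}(l-i-j+x)^n.$$
   Context: $[n]_{p,q}=\frac{p^n-q^n}{p-q}$; $\mathrm{Li}_{k,p,q}(t)=\sum_{n\ge1} t^n/[n]_{p,q}^k$. The $(p,q)$-poly-Euler polynomials are defined by $\frac{2\,\mathrm{Li}_{k,p,q}(1-e^{-t})}{1+e^{t}}e^{xt}=\sum_{n\ge0} E_{n,p,q}^{(k)}(x)\frac{t^n}{n!}$.
   Formalization: The outer series over l diverges in the ordinary sense for every n≥1 (for n=1 its l-th term is 2(-1)^l, while E_1(x)=1); the sum over l is therefore taken as an Abel sum, the limit as r→1⁻ of the series with l-th term multiplied by r^l. *)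

theory Defs
  imports
    "HOL-Analysis.Analysis"
    "HOL-Computational_Algebra.Formal_Power_Series"
begin

definition pq_bracket :: "real \<Rightarrow> real \<Rightarrow> nat \<Rightarrow> real" where
  "pq_bracket p q n = (p ^ n - q ^ n) / (p - q)"

definition pq_polylog :: "int \<Rightarrow> real \<Rightarrow> real \<Rightarrow> 'a::real_normed_field fps" where
  "pq_polylog k p q =
     Abs_fps (\<lambda>n. if n = 0 then 0 else 1 / of_real (pq_bracket p q n) powi k)"

definition pq_poly_Euler_gf ::
    "int \<Rightarrow> real \<Rightarrow> real \<Rightarrow> 'a::real_normed_field \<Rightarrow> 'a fps" where
  "pq_poly_Euler_gf k p q x =
     2 * (pq_polylog k p q oo (1 - fps_exp (- 1))) / (1 + fps_exp 1) * fps_exp x"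

definition pq_poly_Euler ::
    "int \<Rightarrow> real \<Rightarrow> real \<Rightarrow> nat \<Rightarrow> 'a::real_normed_field \<Rightarrow> 'a" where
  "pq_poly_Euler k p q n x = fact n * fps_nth (pq_poly_Euler_gf k p q x) n"

lemma pq_poly_Euler_gf:
  "Abs_fps (\<lambda>n. pq_poly_Euler k p q n x / fact n) = pq_poly_Euler_gf k p q x"
  by (simp add: fps_eq_iff pq_poly_Euler_def)

text \<open>
  The series over \<open>l\<close> in the expansion of the polynomials arises from expanding
  \<open>1 / (1 + exp t)\<close> into \<open>\<Sum>m. (- 1) ^ m * exp (m * t)\<close> and comparing coefficients at
  \<open>t = 0\<close>, the boundary of the region of convergence. Its terms do not tend to zero, so it has
  no sum in the sense of \<^const>\<open>sums\<close>; it is to be read as an Abel sum.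
\<close>

definition abel_sums :: "(nat \<Rightarrow> 'a::real_normed_vector) \<Rightarrow> 'a \<Rightarrow> bool"
    (infixr "abel'_sums" 80) where
  "a abel_sums s \<longleftrightarrow>
     (\<forall>r. 0 \<le> r \<and> r < 1 \<longrightarrow> summable (\<lambda>l. r ^ l *\<^sub>R a l)) \<and>
     ((\<lambda>r. \<Sum>l. r ^ l *\<^sub>R a l) \<longlongrightarrow> s) (at_left 1)"

lemma abel_sums_unique: "a abel_sums s \<Longrightarrow> a abel_sums t \<Longrightarrow> s = t"
  unfolding abel_sums_def
  by (metis tendsto_unique trivial_limit_at_left_real)

lemma sums_imp_abel_sums:
  fixes a :: "nat \<Rightarrow> 'a::banach"
  assumes "a sums s"
  shows "a abel_sums s"
proof -
  define d where "d n = (\<Sum>i<n. a i) - s" for n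
  have d0: "d \<longlonglongrightarrow> 0"
    using assms unfolding sums_def d_def by (simp add: LIM_zero)
  obtain B where B: "B > 0" "\<And>n. norm (d n) \<le> B"
    using d0 convergent_imp_Bseq[of d] unfolding Bseq_def convergent_def by blast
  have sumd: "summable (\<lambda>l. r ^ l *\<^sub>R d (l + c))" if "0 \<le> r" "r < 1" for r :: real and c
  proof (rule summable_comparison_test')
    show "summable (\<lambda>l. B * r ^ l)"
      using that by (intro summable_mult summable_geometric) auto
    show "norm (r ^ n *\<^sub>R d (n + c)) \<le> B * r ^ n" if "n \<ge> 0" for n
      using B(2)[of "n + c"] \<open>0 \<le> r\<close>
      by (simp add: mult.commute[of B] mult_left_mono)
  qed
  have eq: "(\<lambda>l. r ^ l *\<^sub>R a l) sums (s + (1 - r) *\<^sub>R (\<Sum>l. r ^ l *\<^sub>R d (l + 1)))"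
    if r: "0 \<le> r" "r < 1" for r :: real
  proof -
    have al: "r ^ l *\<^sub>R a l = r ^ l *\<^sub>R d (l + 1) - r ^ l *\<^sub>R d l" for l
      by (simp add: d_def algebra_simps)
    have s1: "(\<lambda>l. r ^ l *\<^sub>R d (l + 1)) sums (\<Sum>l. r ^ l *\<^sub>R d (l + 1))"
      using sumd[OF r, of 1] by (simp add: summable_sums)
    have "(\<lambda>l. r ^ Suc l *\<^sub>R d (Suc l)) sums (r *\<^sub>R (\<Sum>l. r ^ l *\<^sub>R d (l + 1)))"
      using sums_scaleR_right[OF s1, of r] by simp
    hence s2: "(\<lambda>l. r ^ l *\<^sub>R d l) sums (r *\<^sub>R (\<Sum>l. r ^ l *\<^sub>R d (l + 1)) + d 0)"
      by (subst (asm) sums_Suc_iff) simp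
    show ?thesis
      using sums_diff[OF s1 s2] unfolding al[symmetric]
      by (simp add: d_def algebra_simps)
  qed
  have lim: "((\<lambda>r. (1 - r) *\<^sub>R (\<Sum>l. r ^ l *\<^sub>R d (l + 1))) \<longlongrightarrow> 0) (at_left (1::real))"
  proof (rule tendstoI)
    fix e :: real assume e: "e > 0"
    then obtain N where N: "\<And>n. n \<ge> N \<Longrightarrow> norm (d n) < e / 2"
      using LIMSEQ_D[OF d0, of "e / 2"] by auto
    have "((\<lambda>r::real. (1 - r) * (N * B)) \<longlongrightarrow> (1 - 1) * (N * B)) (at_left 1)"
      by (intro tendsto_intros)
    hence ev1: "\<forall>\<^sub>F r in at_left (1::real). (1 - r) * (N * B) < e / 2"
      using e by (intro order_tendstoD(2)) auto
    have ev2: "\<forall>\<^sub>F r in at_left (1::real). 0 < r \<and> r < 1"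
      using eventually_at_left_real[of 0 "1::real"] by simp
    show "\<forall>\<^sub>F r in at_left (1::real).
            dist ((1 - r) *\<^sub>R (\<Sum>l. r ^ l *\<^sub>R d (l + 1))) 0 < e"
      using ev1 ev2
    proof eventually_elim
      case (elim r)
      hence r: "0 \<le> r" "r < 1" by auto
      let ?f = "\<lambda>l. r ^ l *\<^sub>R d (l + 1)"
      let ?g = "\<lambda>l. (if l < N then B else 0) + r ^ l * (e / 2)"
      have g: "?g sums (N * B + 1 / (1 - r) * (e / 2))"
        using sums_add[OF sums_If_finite[of "\<lambda>l. l < N" "\<lambda>_. B"]
            sums_mult2[OF geometric_sums[of r], of "e / 2"]] r
        by simp
      have le: "norm (?f l) \<le> ?g l" for l
      proof (cases "l < N")
        case True
        have "norm (?f l) \<le> 1 * B"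
          unfolding norm_scaleR using r B(2)[of "l + 1"]
          by (intro mult_mono) (auto simp: power_le_one)
        also have "\<dots> \<le> ?g l" using True r e by simp
        finally show ?thesis .
      next
        case False
        have "norm (?f l) \<le> r ^ l * (e / 2)"
          unfolding norm_scaleR using False N[of "l + 1"] r by (intro mult_mono) auto
        thus ?thesis using False by simp
      qed
      have sn: "summable (\<lambda>l. norm (?f l))"
        by (rule summable_comparison_test'[OF sums_summable[OF g], of 0]) (use le in simp)
      have "norm (\<Sum>l. ?f l) \<le> (\<Sum>l. norm (?f l))"
        by (rule summable_norm[OF sn])
      also have "\<dots> \<le> suminf ?g"
        by (rule suminf_le[OF le sn sums_summable[OF g]])
      also have "\<dots> = N * B + 1 / (1 - r) * (e / 2)"
        using g by (rule sums_unique[symmetric])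
      finally have "(1 - r) * norm (\<Sum>l. ?f l) \<le> (1 - r) * (N * B + 1 / (1 - r) * (e / 2))"
        using r by (intro mult_left_mono) auto
      also have "\<dots> = (1 - r) * (N * B) + e / 2"
        using r by (simp add: field_simps)
      also have "\<dots> < e" using elim by simp
      finally show ?case using r by simp
    qed
  qed
  have "((\<lambda>r. s + (1 - r) *\<^sub>R (\<Sum>l. r ^ l *\<^sub>R d (l + 1))) \<longlongrightarrow> s + 0) (at_left (1::real))"
    by (intro tendsto_intros lim)
  moreover have "\<forall>\<^sub>F r in at_left (1::real).
      s + (1 - r) *\<^sub>R (\<Sum>l. r ^ l *\<^sub>R d (l + 1)) = (\<Sum>l. r ^ l *\<^sub>R a l)"
  proof -
    have "\<forall>\<^sub>F r in at_left (1::real). r \<in> {0<..<1}"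
      by (rule eventually_at_left_real) simp
    thus ?thesis
    proof eventually_elim
      case (elim r)
      thus ?case using sums_unique[OF eq[of r]] by simp
    qed
  qed
  ultimately have "((\<lambda>r. \<Sum>l. r ^ l *\<^sub>R a l) \<longlongrightarrow> s) (at_left (1::real))"
    using Lim_transform_eventually by fastforce
  thus ?thesis
    unfolding abel_sums_def using eq by (auto intro: sums_summable)
qed

text \<open>Divergence in the case \<open>n = 1\<close>, where the \<open>l\<close>-th term equals \<open>2 * (- 1) ^ l\<close>:\<close>

lemma pq_poly_Euler_series_diverges:
  fixes p q :: real and x :: "'a::real_normed_field"
  assumes "q < p"
  shows "\<not> summable (\<lambda>l. \<Sum>i=0..l. \<Sum>j=0..i+1.
            2 * (- 1) powi (int l - int i - int j) / of_real (pq_bracket p q (i + 1)) powi k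
            * of_nat ((i + 1) choose j) * (of_int (int l - int i - int j) + x) ^ 1)"
    (is "\<not> summable (\<lambda>l. \<Sum>i=0..l. \<Sum>j=0..i+1. ?t l i j)")
proof
  have inner: "(\<Sum>j=0..i+1. ?t l i j) = (if i = 0 then 2 * (- 1) ^ l else 0)" if "i \<le> l" for l i
  proof (cases "i = 0")
    case True
    have "pq_bracket p q 1 = 1" using assms by (simp add: pq_bracket_def)
    thus ?thesis using True
      by (simp add: power_int_diff algebra_simps)
  next
    case False
    define c :: 'a where "c = 2 * (- 1) ^ (l - i) / of_real (pq_bracket p q (i + 1)) powi k"
    define y where "y = of_nat l - of_nat i + x"
    have t: "?t l i j = c * y * ((- 1) ^ j * of_nat ((i + 1) choose j))
        - c * ((- 1) ^ j * of_nat j * of_nat ((i + 1) choose j))" for j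
    proof -
      have "(- 1 :: 'a) powi (int l - int i - int j) = (- 1) powi (int (l - i)) / (- 1) powi int j"
        using that power_int_diff[of "- 1 :: 'a" "int (l - i)" "int j"] by (simp add: of_nat_diff)
      also have "\<dots> = (- 1) ^ (l - i) * (- 1) ^ j"
        by (cases "even j") simp_all
      finally have e: "(- 1 :: 'a) powi (int l - int i - int j) = (- 1) ^ (l - i) * (- 1) ^ j" .
      show ?thesis
        unfolding e c_def y_def by (simp add: algebra_simps diff_divide_distrib add_divide_distrib)
    qed
    have "(\<Sum>j\<le>i+1. (- 1) ^ j * of_nat ((i + 1) choose j)) = (0::'a)"
      by (rule choose_alternating_sum) simp
    moreover have "(\<Sum>j\<le>i+1. (- 1) ^ j * of_nat j * of_nat ((i + 1) choose j)) = (0::'a)"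
      using False by (intro choose_alternating_linear_sum) simp
    ultimately show ?thesis
      using False unfolding t
      by (simp add: sum_subtractf atLeast0AtMost flip: sum_distrib_left)
  qed
  have collapse: "(\<Sum>i=0..l. \<Sum>j=0..i+1. ?t l i j) = 2 * (- 1) ^ l" for l
  proof -
    have "(\<Sum>i=0..l. \<Sum>j=0..i+1. ?t l i j) = (\<Sum>i=0..l. if i = 0 then 2 * (- 1) ^ l else 0)"
      by (rule sum.cong[OF refl], rule inner) simp
    thus ?thesis by simp
  qed
  assume "summable (\<lambda>l. \<Sum>i=0..l. \<Sum>j=0..i+1. ?t l i j)"
  hence "(\<lambda>l. 2 * (- 1 :: 'a) ^ l) \<longlonglongrightarrow> 0"
    unfolding collapse by (rule summable_LIMSEQ_zero)
  hence "(\<lambda>l. norm (2 * (- 1 :: 'a) ^ l)) \<longlonglongrightarrow> 0"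
    by (rule tendsto_norm_zero)
  thus False by (simp add: norm_mult norm_power LIMSEQ_const_iff)
qed

end

theory Submission
  imports Defs
begin

text \<open>
  The inner sum over \<open>j\<close> equals \<open>(- 1) ^ m\<close> times \<open>n!\<close> times the \<open>n\<close>-th coefficient of
  \<open>(1 - exp (- t)) ^ (i + 1) * exp (x * t) * exp (m * t)\<close> with \<open>m = l - i\<close>. It vanishes for
  \<open>i \<ge> n\<close>, so only finitely many \<open>i\<close> contribute, each giving a shifted copy of an alternating
  polynomial sequence in \<open>m\<close>. The Abel sum of \<open>(- 1) ^ m * m ^ d\<close> is \<open>d!\<close> times the \<open>d\<close>-th
  coefficient of \<open>1 / (1 + exp t)\<close>: splitting off the term \<open>m = 0\<close> and expanding \<open>(m + 1) ^ d\<close>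
  yields a recurrence which, in the limit \<open>r \<rightarrow> 1\<close>, is the coefficient recurrence of
  \<open>(1 + exp t) * (1 / (1 + exp t)) = 1\<close>.
\<close>

section \<open>Linearity and shift invariance of Abel summation\<close>

lemma abel_sums_mult_left:
  fixes c :: "'a::real_normed_algebra"
  assumes "a abel_sums s"
  shows "(\<lambda>l. c * a l) abel_sums (c * s)"
proof -
  have sm: "summable (\<lambda>l. r ^ l *\<^sub>R a l)" if "0 \<le> r" "r < 1" for r
    using assms that by (simp add: abel_sums_def)
  have lim: "((\<lambda>r. c * (\<Sum>l. r ^ l *\<^sub>R a l)) \<longlongrightarrow> c * s) (at_left 1)"
    using assms by (auto simp: abel_sums_def intro: tendsto_intros)
  have "\<forall>\<^sub>F r in at_left (1::real). r \<in> {0<..<1}"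
    by (rule eventually_at_left_real) simp
  hence "\<forall>\<^sub>F r in at_left (1::real).
      c * (\<Sum>l. r ^ l *\<^sub>R a l) = (\<Sum>l. r ^ l *\<^sub>R (c * a l))"
    by eventually_elim (simp add: suminf_mult[OF sm, symmetric])
  with lim have "((\<lambda>r. \<Sum>l. r ^ l *\<^sub>R (c * a l)) \<longlongrightarrow> c * s) (at_left 1)"
    by (rule Lim_transform_eventually)
  moreover have "summable (\<lambda>l. r ^ l *\<^sub>R (c * a l))" if "0 \<le> r" "r < 1" for r
    using summable_mult[OF sm[OF that], of c] by simp
  ultimately show ?thesis
    by (simp add: abel_sums_def)
qed

lemma abel_sums_sum:
  assumes "\<And>i. i \<in> I \<Longrightarrow> a i abel_sums s i"
  shows "(\<lambda>l. \<Sum>i\<in>I. a i l) abel_sums (\<Sum>i\<in>I. s i)"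
proof -
  have sm: "summable (\<lambda>l. r ^ l *\<^sub>R a i l)" if "0 \<le> r" "r < 1" "i \<in> I" for r i
    using assms that by (simp add: abel_sums_def)
  have lim: "((\<lambda>r. \<Sum>i\<in>I. \<Sum>l. r ^ l *\<^sub>R a i l) \<longlongrightarrow> (\<Sum>i\<in>I. s i)) (at_left 1)"
    using assms by (intro tendsto_sum) (auto simp: abel_sums_def)
  have "\<forall>\<^sub>F r in at_left (1::real). r \<in> {0<..<1}"
    by (rule eventually_at_left_real) simp
  hence "\<forall>\<^sub>F r in at_left (1::real).
      (\<Sum>i\<in>I. \<Sum>l. r ^ l *\<^sub>R a i l) = (\<Sum>l. r ^ l *\<^sub>R (\<Sum>i\<in>I. a i l))"
  proof eventually_elim
    case (elim r)
    thus ?case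
      using suminf_sum[of I "\<lambda>i l. r ^ l *\<^sub>R a i l"] sm by (simp add: scaleR_sum_right)
  qed
  with lim have "((\<lambda>r. \<Sum>l. r ^ l *\<^sub>R (\<Sum>i\<in>I. a i l)) \<longlongrightarrow> (\<Sum>i\<in>I. s i)) (at_left 1)"
    by (rule Lim_transform_eventually)
  moreover have "summable (\<lambda>l. r ^ l *\<^sub>R (\<Sum>i\<in>I. a i l))" if "0 \<le> r" "r < 1" for r
    unfolding scaleR_sum_right using sm that by (intro summable_sum) auto
  ultimately show ?thesis
    by (simp add: abel_sums_def)
qed

text \<open>Prepending \<open>i\<close> zeros multiplies the damped series by \<open>r ^ i\<close>,
  which tends to 1 as \<open>r\<close> tends to 1.\<close>

lemma abel_sums_shift:
  assumes "a abel_sums s"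
  shows "(\<lambda>l. if i \<le> l then a (l - i) else 0) abel_sums s"
proof -
  define b where "b l = (if i \<le> l then a (l - i) else 0)" for l
  have sums: "(\<lambda>l. r ^ l *\<^sub>R b l) sums (r ^ i *\<^sub>R (\<Sum>l. r ^ l *\<^sub>R a l))"
    if "0 \<le> r" "r < 1" for r
  proof -
    have "(\<lambda>l. r ^ l *\<^sub>R a l) sums (\<Sum>l. r ^ l *\<^sub>R a l)"
      using assms that by (intro summable_sums) (simp add: abel_sums_def)
    from sums_scaleR_right[OF this, of "r ^ i"]
    have "(\<lambda>l. r ^ (l + i) *\<^sub>R b (l + i)) sums (r ^ i *\<^sub>R (\<Sum>l. r ^ l *\<^sub>R a l))"
      by (simp add: b_def power_add mult.commute)
    moreover have "(\<Sum>l<i. r ^ l *\<^sub>R b l) = 0"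
      by (intro sum.neutral) (simp add: b_def)
    ultimately show ?thesis
      by (subst (asm) sums_iff_shift) simp
  qed
  have "((\<lambda>r. r ^ i *\<^sub>R (\<Sum>l. r ^ l *\<^sub>R a l)) \<longlongrightarrow> 1 ^ i *\<^sub>R s) (at_left (1::real))"
    using assms by (intro tendsto_intros) (simp add: abel_sums_def)
  hence lim: "((\<lambda>r. r ^ i *\<^sub>R (\<Sum>l. r ^ l *\<^sub>R a l)) \<longlongrightarrow> s) (at_left 1)"
    by simp
  have "\<forall>\<^sub>F r in at_left (1::real). r \<in> {0<..<1}"
    by (rule eventually_at_left_real) simp
  hence "\<forall>\<^sub>F r in at_left (1::real).
      r ^ i *\<^sub>R (\<Sum>l. r ^ l *\<^sub>R a l) = (\<Sum>l. r ^ l *\<^sub>R b l)"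
    by eventually_elim (rule sums_unique[OF sums], auto)
  with lim have "((\<lambda>r. \<Sum>l. r ^ l *\<^sub>R b l) \<longlongrightarrow> s) (at_left 1)"
    by (rule Lim_transform_eventually)
  thus ?thesis
    using sums unfolding abel_sums_def b_def[symmetric] by (auto intro: sums_summable)
qed

section \<open>Abel sums of alternating powers\<close>

text \<open>Differentiating termwise and multiplying by \<open>z\<close> raises the exponent
  \<open>d\<close> by one and keeps convergence in the open unit disc.\<close>

lemma summable_of_nat_power_mult_power:
  fixes z :: "'a::{real_normed_field, banach}"
  assumes "norm z < 1"
  shows "summable (\<lambda>m. of_nat m ^ d * z ^ m)"
  using assms
proof (induction d arbitrary: z)
  case 0
  thus ?case by (simp add: summable_geometric)
next
  case (Suc d)
  have "summable (\<lambda>m. diffs (\<lambda>m. of_nat m ^ d) m * z ^ m)"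
    using Suc by (intro termdiff_converges[of z 1]) auto
  hence "summable (\<lambda>m. z * (diffs (\<lambda>m. of_nat m ^ d) m * z ^ m))"
    by (rule summable_mult)
  hence "summable (\<lambda>m. of_nat (Suc m) ^ Suc d * z ^ Suc m)"
    by (simp add: diffs_def algebra_simps del: of_nat_Suc)
  thus ?case
    by (subst (asm) summable_Suc_iff)
qed

text \<open>In the coefficient of \<open>G * (1 + fps_exp 1) = 1\<close>, both \<open>G\<close> and
  the top term of the convolution \<open>G * fps_exp 1\<close> contribute \<open>g d\<close>, hence
  the factor 2.\<close>

lemma inverse_one_plus_fps_exp_nth:
  fixes d :: nat
  defines "g \<equiv> \<lambda>e. fact e * fps_nth (inverse (1 + fps_exp 1)) e :: 'a::real_normed_field"
  shows "2 * g d = (if d = 0 then 1 else 0) - (\<Sum>e<d. of_nat (d choose e) * g e)"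
proof -
  define G :: "'a fps" where "G = inverse (1 + fps_exp 1)"
  have "G * (1 + fps_exp 1) = 1"
    unfolding G_def by (intro inverse_mult_eq_1) simp
  hence "fps_nth (G + G * fps_exp 1) d = fps_nth 1 d"
    by (simp add: algebra_simps)
  hence "fact d * (fps_nth G d + (\<Sum>e\<le>d. fps_nth G e / fact (d - e)))
      = (if d = 0 then 1 else 0)"
    by (simp add: fps_mult_nth atLeast0AtMost)
  moreover have "fact d * (fps_nth G e / fact (d - e)) = of_nat (d choose e) * g e"
    if "e \<le> d" for e
    using that by (simp add: g_def G_def binomial_fact)
  hence "fact d * (\<Sum>e\<le>d. fps_nth G e / fact (d - e)) = (\<Sum>e\<le>d. of_nat (d choose e) * g e)"
    by (simp add: sum_distrib_left)
  ultimately have "g d + (\<Sum>e\<le>d. of_nat (d choose e) * g e) = (if d = 0 then 1 else 0)"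
    by (simp add: g_def G_def distrib_left)
  moreover have "(\<Sum>e\<le>d. of_nat (d choose e) * g e) = (\<Sum>e<d. of_nat (d choose e) * g e) + g d"
    by (simp flip: lessThan_Suc_atMost)
  ultimately show ?thesis
    by (simp add: algebra_simps)
qed

lemma abel_sums_alternating_power:
  "(\<lambda>m. (- 1) ^ m * of_nat m ^ d) abel_sums
     (fact d * fps_nth (inverse (1 + fps_exp 1)) d :: 'a::{real_normed_field, banach})"
proof -
  define g :: "nat \<Rightarrow> 'a" where "g e = fact e * fps_nth (inverse (1 + fps_exp 1)) e" for e
  define S :: "nat \<Rightarrow> real \<Rightarrow> 'a" where "S d r = (\<Sum>m. of_nat m ^ d * (- of_real r) ^ m)" for d r
  have term_eq: "r ^ m *\<^sub>R ((- 1) ^ m * of_nat m ^ d :: 'a) = of_nat m ^ d * (- of_real r) ^ m"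
    for r m d
    by (simp add: scaleR_conv_of_real power_minus[of "of_real r"] mult_ac)
  have sm: "summable (\<lambda>m. of_nat m ^ d * (- of_real r :: 'a) ^ m)" if "0 \<le> r" "r < 1" for r d
    using that by (intro summable_of_nat_power_mult_power) simp
  have rec: "S d r = ((if d = 0 then 1 else 0)
      - of_real r * (\<Sum>e<d. of_nat (d choose e) * S e r)) / (1 + of_real r)"
    if r: "0 \<le> r" "r < 1" for r d
  proof -
    have "(\<Sum>m. of_nat (Suc m) ^ d * (- of_real r :: 'a) ^ Suc m)
        = (\<Sum>m. - of_real r * (\<Sum>e\<le>d. of_nat (d choose e) * (of_nat m ^ e * (- of_real r) ^ m)))"
    proof (rule suminf_cong)
      fix m
      have "(of_nat (Suc m) :: 'a) ^ d = (\<Sum>e\<le>d. of_nat (d choose e) * of_nat m ^ e)"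
        using binomial_ring[of "of_nat m :: 'a" 1 d] by (simp add: add.commute)
      thus "of_nat (Suc m) ^ d * (- of_real r :: 'a) ^ Suc m
          = - of_real r * (\<Sum>e\<le>d. of_nat (d choose e) * (of_nat m ^ e * (- of_real r) ^ m))"
        by (simp add: sum_distrib_left sum_distrib_right mult_ac del: of_nat_Suc)
    qed
    also have "\<dots> = - of_real r * (\<Sum>e\<le>d. of_nat (d choose e) * S e r)"
      unfolding S_def
      by (subst suminf_mult, intro summable_sum summable_mult sm r)
         (simp add: suminf_sum suminf_mult summable_mult sm r)
    \<comment> \<open>The split-off term \<open>m = 0\<close> is \<open>0 ^ d\<close>, which is 1
      exactly for \<open>d = 0\<close>.\<close>
    finally have "S d r = (if d = 0 then 1 else 0)
        - of_real r * (\<Sum>e\<le>d. of_nat (d choose e) * S e r)"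
      using suminf_split_head[OF sm[OF r, of d]]
      by (simp add: S_def[symmetric] power_0_left algebra_simps del: of_nat_Suc power_Suc)
    \<comment> \<open>Moving the term \<open>e = d\<close> to the left yields the factor
      \<open>1 + of_real r\<close>; only smaller exponents remain on the right.\<close>
    also have "(\<Sum>e\<le>d. of_nat (d choose e) * S e r)
        = (\<Sum>e<d. of_nat (d choose e) * S e r) + S d r"
      by (simp flip: lessThan_Suc_atMost)
    finally have "S d r * (1 + of_real r) = (if d = 0 then 1 else 0)
        - of_real r * (\<Sum>e<d. of_nat (d choose e) * S e r)"
      by (simp add: algebra_simps)
    moreover have "(1 + of_real r :: 'a) \<noteq> 0"
      using r by (metis add_nonneg_eq_0_iff of_real_1 of_real_add of_real_eq_0_iff zero_le_one
          zero_neq_one)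
    ultimately show ?thesis
      by (simp add: eq_divide_eq)
  qed
  \<comment> \<open>At \<open>r = 1\<close> the denominator is 2 and the recurrence is the one
    satisfied by \<open>g\<close>, so strong induction on \<open>d\<close> passes to the
    limit.\<close>
  have "(S d \<longlongrightarrow> g d) (at_left 1)" for d
  proof (induction d rule: less_induct)
    case (less d)
    have "((\<lambda>r. ((if d = 0 then 1 else 0) - of_real r * (\<Sum>e<d. of_nat (d choose e) * S e r))
              / (1 + of_real r))
        \<longlongrightarrow> ((if d = 0 then 1 else 0) - of_real 1 * (\<Sum>e<d. of_nat (d choose e) * g e))
              / (1 + of_real 1)) (at_left 1)"
      using less by (intro tendsto_intros) auto
    also have "((if d = 0 then 1 else 0) - of_real 1 * (\<Sum>e<d. of_nat (d choose e) * g e))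
        / (1 + of_real 1) = g d"
      using inverse_one_plus_fps_exp_nth[of d, where ?'a = 'a] by (simp add: g_def divide_eq_eq mult.commute)
    finally have lim: "((\<lambda>r. ((if d = 0 then 1 else 0)
        - of_real r * (\<Sum>e<d. of_nat (d choose e) * S e r)) / (1 + of_real r)) \<longlongrightarrow> g d) (at_left 1)" .
    have "\<forall>\<^sub>F r in at_left (1::real). r \<in> {0<..<1}"
      by (rule eventually_at_left_real) simp
    hence "\<forall>\<^sub>F r in at_left (1::real). ((if d = 0 then 1 else 0)
        - of_real r * (\<Sum>e<d. of_nat (d choose e) * S e r)) / (1 + of_real r) = S d r"
      by eventually_elim (rule rec[symmetric], auto)
    with lim show ?case
      by (rule Lim_transform_eventually)
  qed
  thus ?thesis
    unfolding abel_sums_def term_eq using sm by (simp add: S_def[abs_def] g_def)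
qed

text \<open>The \<open>n\<close>-th coefficient is a polynomial in \<open>m\<close> whose term
  \<open>m ^ (n - e)\<close> carries \<open>1 / fact (n - e)\<close>. This cancels the factorial in
  the Abel sum of the alternating powers, leaving a Cauchy product.\<close>

lemma abel_sums_alternating_fps_exp:
  fixes F :: "'a::{real_normed_field, banach} fps"
  shows "(\<lambda>m. (- 1) ^ m * fps_nth (F * fps_exp (of_nat m)) n)
    abel_sums fps_nth (F * inverse (1 + fps_exp 1)) n"
proof -
  have "(\<lambda>m. \<Sum>e=0..n. fps_nth F e / fact (n - e) * ((- 1) ^ m * of_nat m ^ (n - e)))
      abel_sums (\<Sum>e=0..n. fps_nth F e / fact (n - e)
        * (fact (n - e) * fps_nth (inverse (1 + fps_exp 1)) (n - e)))"
    by (intro abel_sums_sum abel_sums_mult_left abel_sums_alternating_power)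
  thus ?thesis
    by (simp add: fps_mult_nth sum_distrib_left mult_ac)
qed

section \<open>Coefficients of compositions and of powers of
  \<open>1 - fps_exp (- 1)\<close>\<close>

text \<open>Since \<open>b ^ i\<close> has order at least \<open>i\<close>, every coefficient up to
  \<open>n\<close> of the composition can be cut off at the same bound \<open>n\<close>, and the
  finite sums can be swapped.\<close>

lemma fps_compose_mult_nth:
  fixes a b c :: "'a::idom fps"
  assumes "fps_nth b 0 = 0"
  shows "fps_nth ((a oo b) * c) n = (\<Sum>i=0..n. fps_nth a i * fps_nth (b ^ i * c) n)"
proof -
  have "fps_nth (a oo b) m = (\<Sum>i=0..n. fps_nth a i * fps_nth (b ^ i) m)" if "m \<le> n" for m
    unfolding fps_compose_nth using that assms
    by (intro sum.mono_neutral_left) (auto simp: startsby_zero_power_prefix)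
  hence "fps_nth ((a oo b) * c) n
      = (\<Sum>m=0..n. (\<Sum>i=0..n. fps_nth a i * fps_nth (b ^ i) m) * fps_nth c (n - m))"
    by (simp add: fps_mult_nth)
  also have "\<dots> = (\<Sum>i=0..n. fps_nth a i * fps_nth (b ^ i * c) n)"
    unfolding fps_mult_nth sum_distrib_left sum_distrib_right
    by (subst sum.swap) (simp add: mult_ac)
  finally show ?thesis .
qed

text \<open>The binomial theorem turns the left side into a combination of the exponentials
  \<open>fps_exp (y - of_nat j)\<close>. This is what evaluates the sum over \<open>j\<close> in the
  theorem.\<close>

lemma one_minus_fps_exp_power_mult_nth:
  fixes y :: "'a::field_char_0"
  shows "fact n * fps_nth ((1 - fps_exp (- 1)) ^ N * fps_exp y) n
    = (\<Sum>j=0..N. (- 1) ^ j * of_nat (N choose j) * (y - of_nat j) ^ n)"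
proof -
  have "(1 - fps_exp (- 1 :: 'a)) ^ N = (\<Sum>j\<le>N. of_nat (N choose j) * (- fps_exp (- 1)) ^ j)"
    using binomial_ring[of "- fps_exp (- 1 :: 'a)" 1 N] by simp
  also have "\<dots> = (\<Sum>j\<le>N. fps_const ((- 1) ^ j * of_nat (N choose j)) * fps_exp (- of_nat j))"
    by (intro sum.cong refl)
       (simp add: power_minus[of "fps_exp _"] fps_exp_power_mult fps_of_nat
          flip: fps_const_mult fps_const_power fps_const_neg)
  finally have "(1 - fps_exp (- 1 :: 'a)) ^ N * fps_exp y
      = (\<Sum>j\<le>N. fps_const ((- 1) ^ j * of_nat (N choose j)) * fps_exp (y - of_nat j))"
    by (simp add: sum_distrib_right mult.assoc flip: fps_exp_add_mult)
  thus ?thesis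
    by (simp add: fps_sum_nth sum_distrib_left atLeast0AtMost)
qed

theorem theorem3:
  fixes p q :: real and k :: int and n :: nat
    and x :: "'a::{real_normed_field, banach}"
  assumes "0 < q" and "q < p" and "p \<le> 1" and "n \<ge> 1"
  shows "(\<lambda>l. \<Sum>i=0..l. \<Sum>j=0..i+1.
            2 * (- 1) powi (int l - int i - int j) / of_real (pq_bracket p q (i + 1)) powi k
            * of_nat ((i + 1) choose j) * (of_int (int l - int i - int j) + x) ^ n)
         abel_sums pq_poly_Euler k p q n x"
    (is "(\<lambda>l. \<Sum>i=0..l. \<Sum>j=0..i+1. ?t l i j) abel_sums _")
proof -
  define B :: "'a fps" where "B = 1 - fps_exp (- 1)"
  define c :: "nat \<Rightarrow> 'a" where "c i = 1 / of_real (pq_bracket p q (i + 1)) powi k" for i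
  \<comment> \<open>With \<open>m = l - i\<close>, \<open>u i m\<close> is the inner sum over
    \<open>j\<close>, and \<open>v i\<close> is the Abel sum of \<open>u i\<close> over
    \<open>m\<close>.\<close>
  define u where "u i m = 2 * fact n * c i
      * ((- 1) ^ m * fps_nth (B ^ (i + 1) * fps_exp x * fps_exp (of_nat m)) n)" for i m
  define v where "v i = 2 * fact n * c i
      * fps_nth (B ^ (i + 1) * fps_exp x * inverse (1 + fps_exp 1)) n" for i
  have B0: "fps_nth B 0 = 0"
    by (simp add: B_def)
  have u_zero: "u i m = 0" if "n \<le> i" for i m
  proof -
    \<comment> \<open>\<open>B ^ (i + 1)\<close> has order at least \<open>i + 1\<close>, which
      exceeds \<open>n\<close>.\<close>
    have "fps_nth (B ^ (i + 1)) e = 0" if "e \<le> n" for e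
      using startsby_zero_power_prefix[OF B0, of "i + 1"] that \<open>n \<le> i\<close> by auto
    hence "fps_nth (B ^ (i + 1) * (fps_exp x * fps_exp (of_nat m))) n = 0"
      unfolding fps_mult_nth[of "B ^ (i + 1)"] by (intro sum.neutral) auto
    thus ?thesis by (simp add: u_def mult.assoc)
  qed
  have inner: "(\<Sum>j=0..i+1. ?t l i j) = u i (l - i)" if "i \<le> l" for l i
  proof -
    define m where "m = l - i"
    have t: "?t l i j = 2 * c i * (- 1) ^ m
        * ((- 1) ^ j * of_nat ((i + 1) choose j) * (x + of_nat m - of_nat j) ^ n)" for j
    proof -
      have lij: "int l - int i - int j = int m - int j"
        using that by (simp add: m_def)
      \<comment> \<open>The exponent may be negative, but \<open>(- 1) ^ j\<close> is its own
        inverse.\<close>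
      have "(- 1 :: 'a) powi (int m - int j) = (- 1) ^ m * (- 1) ^ j"
        by (cases "even j") (simp_all add: power_int_diff)
      thus ?thesis
        unfolding lij by (simp add: c_def algebra_simps)
    qed
    have "(\<Sum>j=0..i+1. ?t l i j)
        = 2 * c i * (- 1) ^ m * (fact n * fps_nth (B ^ (i + 1) * fps_exp (x + of_nat m)) n)"
      unfolding t B_def one_minus_fps_exp_power_mult_nth by (simp only: sum_distrib_left)
    thus ?thesis
      by (simp add: u_def m_def fps_exp_add_mult mult_ac)
  qed
  \<comment> \<open>The range \<open>i < n\<close> is independent of \<open>l\<close>, so finite
    additivity applies; the conditional encodes \<open>i \<le> l\<close> in the form of a shifted
    sequence.\<close>
  have "(\<lambda>l. \<Sum>i<n. if i \<le> l then u i (l - i) else 0) abel_sums (\<Sum>i<n. v i)"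
    unfolding u_def v_def
    by (intro abel_sums_sum abel_sums_shift abel_sums_mult_left abel_sums_alternating_fps_exp)
  also have "(\<lambda>l. \<Sum>i<n. if i \<le> l then u i (l - i) else 0) = (\<lambda>l. \<Sum>i=0..l. \<Sum>j=0..i+1. ?t l i j)"
  proof
    fix l
    have "(\<Sum>i<n. if i \<le> l then u i (l - i) else 0) = (\<Sum>i\<in>{..<n} \<inter> {0..l}. u i (l - i))"
      by (subst sum.inter_restrict) (auto intro: sum.cong)
    also have "\<dots> = (\<Sum>i=0..l. u i (l - i))"
      by (rule sum.mono_neutral_left) (auto, metis u_zero not_less)
    also have "\<dots> = (\<Sum>i=0..l. \<Sum>j=0..i+1. ?t l i j)"
      by (rule sum.cong[OF refl], rule inner[symmetric]) simp
    finally show "(\<Sum>i<n. if i \<le> l then u i (l - i) else 0) = (\<Sum>i=0..l. \<Sum>j=0..i+1. ?t l i j)" .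
  qed
  also have "(\<Sum>i<n. v i) = pq_poly_Euler k p q n x"
  proof -
    define H :: "'a fps" where "H = fps_exp x * inverse (1 + fps_exp 1)"
    \<comment> \<open>\<open>1 + fps_exp 1\<close> has constant coefficient 2, so the division is
      multiplication by its inverse.\<close>
    have "pq_poly_Euler_gf k p q x = fps_const 2 * ((pq_polylog k p q oo B) * H)"
      by (simp add: pq_poly_Euler_gf_def B_def H_def fps_divide_unit numeral_fps_const mult_ac)
    hence "pq_poly_Euler k p q n x
        = 2 * fact n * (\<Sum>i=0..n. fps_nth (pq_polylog k p q) i * fps_nth (B ^ i * H) n)"
      by (simp add: pq_poly_Euler_def fps_compose_mult_nth[OF B0])
    \<comment> \<open>The polylogarithm has constant coefficient 0; reindexing the rest by
      \<open>i + 1\<close> matches the brackets in \<open>c\<close>.\<close>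
    also have "(\<Sum>i=0..n. fps_nth (pq_polylog k p q) i * fps_nth (B ^ i * H) n)
        = (\<Sum>i<n. c i * fps_nth (B ^ (i + 1) * H) n)"
      by (simp add: sum.atLeast_Suc_atMost sum.atLeast1_atMost_eq pq_polylog_def c_def)
    finally show ?thesis
      by (simp add: v_def H_def sum_distrib_left mult_ac)
  qed
  finally show ?thesis .
qed

end
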